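(* Let $1\le k\le n$, $x=(x',x'')\in\mathbb{R}^k\times\mathbb{R}^{n-k}$, $1<p,q<\infty$, $0<r<\infty$ with $p+q\ge r$, $\delta\in[0,1]\cap\left[\frac{r-q}{r},\frac{p}{r}\right]$, and $\alpha,b,c\in\mathbb{R}$ with $\frac{\delta r}{p}+\frac{(1-\delta)r}{q}=1$ and $c=-\delta+b(1-\delta)$. Then for every complex-valued $f\in C_0^\infty(\mathbb{R}^n\setminus\{x'=0\})$, $$\left|\frac{k-\alpha}{p}\right|^\delta\left\||x'|_k^{\alpha c/p}f\right\|_{L^r(\mathbb{R}^n)}\le\left[\left\|\frac{x'\cdot\nabla_kf}{|x'|_k^{\alpha/p}}\right\|_{L^p(\mathbb{R}^n)}^p-\int_{\mathbb{R}^n}C_p\!\left(\frac{x'\cdot\nabla_kf}{|x'|_k^{\alpha/p}},\frac{x'\cdot\nabla_kf}{|x'|_k^{\alpha/p}}+\frac{k-\alpha}{p}\frac{f}{|x'|_k^{\alpha/p}}\right)dx\right]^{\delta/p}\left\||x'|_k^{\alpha b/p}f\right\|_{L^q(\mathbb{R}^n)}^{1-\delta}$$ (the bracket being nonnegative). Moreover, when $\alpha\neq k$, the constant $\left|\frac{k-\alpha}{p}\right|^\delta$ is sharp in the case $q=p$ with $b=-1$, and in the cases $\delta\in\{0,1\}$.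
   Context: $|\cdot|_k$ is the Euclidean norm on $\mathbb{R}^k$, $\nabla_k=(\partial_{x_1},\dots,\partial_{x_k})$, $x'\cdot\nabla_kf=\sum_{j=1}^kx_j\partial_{x_j}f$. For complex $\xi,\eta$, $C_p(\xi,\eta):=|\xi|^p-|\xi-\eta|^p-p|\xi-\eta|^{p-2}\operatorname{Re}((\xi-\eta)\overline{\eta})$ (last term $0$ when $\xi=\eta$). Sharp means the constant on the left cannot be replaced by any larger constant. *)

theory Defs
  imports "HOL-Analysis.Analysis"
begin

text \<open>Points of R^n are vectors x :: real^'n; the first block x' of k coordinates
  is represented by a nonempty set K of coordinate indices with card K = k.\<close>

definition normK :: "'n::finite set \<Rightarrow> real^'n \<Rightarrow> real" where
  "normK K x = sqrt (\<Sum>i\<in>K. (x $ i)^2)"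

definition partial :: "(real^'n::finite \<Rightarrow> complex) \<Rightarrow> 'n \<Rightarrow> real^'n \<Rightarrow> complex" where
  "partial f i x = frechet_derivative f (at x) (axis i 1)"

definition radderK :: "'n::finite set \<Rightarrow> (real^'n \<Rightarrow> complex) \<Rightarrow> real^'n \<Rightarrow> complex" where
  "radderK K f x = (\<Sum>i\<in>K. complex_of_real (x $ i) * partial f i x)"

fun Cm :: "nat \<Rightarrow> (real^'n::finite \<Rightarrow> complex) \<Rightarrow> bool" where
  "Cm 0 f = continuous_on UNIV f"
| "Cm (Suc m) f = (continuous_on UNIV f \<and> (\<forall>x. f differentiable (at x)) \<and>
                    (\<forall>i. Cm m (partial f i)))"

text \<open>C_0^infinity(R^n minus {x' = 0}): smooth, compact support contained in {x' \<noteq> 0}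
  (extended by zero to all of R^n)\<close>
definition C0inf_off :: "'n::finite set \<Rightarrow> (real^'n \<Rightarrow> complex) set" where
  "C0inf_off K = {f. (\<forall>m. Cm m f) \<and> compact (closure {x. f x \<noteq> 0}) \<and>
                     closure {x. f x \<noteq> 0} \<subseteq> {x. normK K x \<noteq> 0}}"

definition Lpnorm :: "real \<Rightarrow> (real^'n::finite \<Rightarrow> complex) \<Rightarrow> real" where
  "Lpnorm r g = (\<integral>x. norm (g x) powr r \<partial>lborel) powr (1 / r)"

definition Cp :: "real \<Rightarrow> complex \<Rightarrow> complex \<Rightarrow> real" where
  "Cp p \<xi> \<eta> = (if \<xi> = \<eta> then norm \<xi> powr p
     else norm \<xi> powr p - norm (\<xi> - \<eta>) powr p
          - p * norm (\<xi> - \<eta>) powr (p - 2) * Re ((\<xi> - \<eta>) * cnj \<eta>))"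

definition rpow :: "real \<Rightarrow> real \<Rightarrow> real" where
  "rpow t a = (if a = 0 then 1 else t powr a)"

definition bracket :: "'n::finite set \<Rightarrow> real \<Rightarrow> real \<Rightarrow> (real^'n \<Rightarrow> complex) \<Rightarrow> real" where
  "bracket K p \<alpha> f =
    (let k = real (card K);
         \<xi> = (\<lambda>x. radderK K f x / complex_of_real (normK K x powr (\<alpha> / p)));
         \<eta> = (\<lambda>x. \<xi> x + complex_of_real ((k - \<alpha>) / p) * f x / complex_of_real (normK K x powr (\<alpha> / p)))
     in Lpnorm p \<xi> powr p - (\<integral>x. Cp p (\<xi> x) (\<eta> x) \<partial>lborel))"

end

theory Submission
  imports Defs
begin

text \<open>Write $\beta = (k-\alpha)/p$. The integrand of the bracket is
  $|\beta|^p\,|x'|^{-\alpha}|f|^p$ minus $\beta|\beta|^{p-2}$ times the divergence of the field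
  $x'\,|x'|^{-\alpha}|f|^p$, which is compactly supported away from $x' = 0$. Hence the bracket
  equals $|\beta|^p \int |x'|^{-\alpha}|f|^p$, and the inequality is Hoelder's inequality between
  $L^p$ and $L^q$. In each of the three sharpness cases Hoelder's inequality is an equality for
  every $f$, so any nonzero test function is extremal.\<close>

text \<open>Why a divergence appears: \<open>Cp p \<xi> \<eta>\<close> is the first-order Taylor
  remainder of \<open>|.|^p\<close> at the point \<open>\<xi> - \<eta>\<close>, which here is
  \<open>-\<beta> f / |x'|^(\<alpha>/p)\<close>. Subtracting it from \<open>|\<xi>|^p\<close> leaves
  the tangent approximation, which is affine in the radial derivative of \<open>f\<close> and
  contains it only through \<open>|f|^(p-2) Re (f cnj (x'.\<nabla>f))\<close>, that is, through the
  derivative of \<open>|f|^p\<close>. Two obstacles shape the argument. For \<open>1 < p < 2\<close>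
  the function \<open>|f|^p\<close> has in general no second derivative at zeros of
  \<open>f\<close>, and \<open>|f|^(p-2)\<close> is unbounded there, so the vanishing of the
  integral must rest on a single bounded derivative. The weights are singular on
  \<open>x' = 0\<close>, so pointwise claims are split into points of the closed support, where
  \<open>x' \<noteq> 0\<close>, and points off it, where everything vanishes locally.\<close>

section \<open>Hoelder's inequality in interpolation form\<close>

text \<open>Weighted AM-GM is integrated after dividing \<open>u\<close> and \<open>v\<close> by
  their integrals. The exponents sit on the integrands, so no norms or roots enter.\<close>

lemma integral_powr_interpolation:
  fixes u v :: "'a \<Rightarrow> real"
  assumes u: "integrable M u" "\<And>x. 0 \<le> u x" and v: "integrable M v" "\<And>x. 0 \<le> v x"
    and \<theta>: "0 < \<theta>" "\<theta> < 1"
  shows "(\<integral>x. u x powr \<theta> * v x powr (1 - \<theta>) \<partial>M)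
    \<le> (\<integral>x. u x \<partial>M) powr \<theta> * (\<integral>x. v x \<partial>M) powr (1 - \<theta>)"
proof -
  define U V where "U = (\<integral>x. u x \<partial>M)" and "V = (\<integral>x. v x \<partial>M)"
  have nn: "0 \<le> U" "0 \<le> V"
    unfolding U_def V_def using u v by (auto intro: integral_nonneg_AE)
  have meas[measurable]: "u \<in> borel_measurable M" "v \<in> borel_measurable M"
    using u v by auto
  show ?thesis
  \<comment> \<open>Normalisation fails when an integral is zero; then one factor vanishes almost
    everywhere, and the product with it because \<open>0 powr \<theta> = 0\<close>.\<close>
  proof (cases "U = 0 \<or> V = 0")
    case True
    then have "(AE x in M. u x = 0) \<or> (AE x in M. v x = 0)"
      using integral_nonneg_eq_0_iff_AE[OF u(1)] integral_nonneg_eq_0_iff_AE[OF v(1)] u v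
      by (auto simp: U_def V_def)
    then have "AE x in M. u x powr \<theta> * v x powr (1 - \<theta>) = 0"
      by (auto elim: eventually_mono)
    then have "(\<integral>x. u x powr \<theta> * v x powr (1 - \<theta>) \<partial>M) = 0"
      by (rule integral_eq_zero_AE)
    then show ?thesis by simp
  next
    case False
    then have pos: "0 < U" "0 < V" using nn by auto
    have young: "u x powr \<theta> * v x powr (1 - \<theta>) \<le>
        U powr \<theta> * V powr (1 - \<theta>) * (\<theta> * (u x / U) + (1 - \<theta>) * (v x / V))" for x
    proof -
      have "u x powr \<theta> * v x powr (1 - \<theta>)
          = U powr \<theta> * V powr (1 - \<theta>) * ((u x / U) powr \<theta> * (v x / V) powr (1 - \<theta>))"
        using pos u v by (simp add: powr_divide)
      also have "(u x / U) powr \<theta> * (v x / V) powr (1 - \<theta>) \<le> \<theta> * (u x / U) + (1 - \<theta>) * (v x / V)"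
      proof (cases "u x = 0 \<or> v x = 0")
        case True
        then show ?thesis using \<theta> u v pos by auto
      next
        case False
        then have "0 < u x" "0 < v x"
          using u(2)[of x] v(2)[of x] by auto
        then show ?thesis using \<theta> pos by (intro Youngs_inequality_0) auto
      qed
      finally show ?thesis by (simp add: mult_left_mono)
    qed
    have int: "integrable M (\<lambda>x. U powr \<theta> * V powr (1 - \<theta>) * (\<theta> * (u x / U) + (1 - \<theta>) * (v x / V)))"
      using u v by auto
    have "(\<integral>x. u x powr \<theta> * v x powr (1 - \<theta>) \<partial>M) \<le>
       (\<integral>x. U powr \<theta> * V powr (1 - \<theta>) * (\<theta> * (u x / U) + (1 - \<theta>) * (v x / V)) \<partial>M)"
    proof (rule integral_mono[OF _ int young])
      show "integrable M (\<lambda>x. u x powr \<theta> * v x powr (1 - \<theta>))"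
        by (rule Bochner_Integration.integrable_bound[OF int])
           (use young in \<open>auto intro: order_trans[OF _ abs_ge_self]\<close>)
    qed
    also have "\<dots> = U powr \<theta> * V powr (1 - \<theta>) * (\<theta> * (U / U) + (1 - \<theta>) * (V / V))"
      using u v by (simp add: U_def V_def)
    also have "\<dots> = U powr \<theta> * V powr (1 - \<theta>)"
      using pos by simp
    finally show ?thesis unfolding U_def V_def .
  qed
qed

section \<open>Integrals of derivatives of compactly supported functions\<close>

text \<open>Continuity is asked on \<open>S\<close> only, since the weights \<open>|x'|^s\<close>
  may be discontinuous at \<open>x' = 0\<close>; a jump across the boundary of \<open>S\<close> does
  no harm.\<close>

lemma integrable_continuous_on_compact:
  fixes g :: "'a::euclidean_space \<Rightarrow> 'b::{banach, second_countable_topology}"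
  assumes "compact S" "continuous_on S g" "\<And>x. x \<notin> S \<Longrightarrow> g x = 0"
  shows "integrable lborel g"
proof -
  have "(\<lambda>x. indicator S x *\<^sub>R g x) = g"
    using assms(3) by (auto simp: indicator_def)
  then show ?thesis
    using borel_integrable_compact[OF assms(1,2)] by simp
qed

text \<open>Difference quotients integrate to zero by translation invariance; dominated convergence
  passes this on to the derivative.\<close>

lemma integral_directional_derivative_eq_0:
  fixes G :: "'a::euclidean_space \<Rightarrow> real"
  assumes S: "compact S" "\<And>x. x \<notin> S \<Longrightarrow> G x = 0"
    and der: "\<And>x. (G has_derivative G' x) (at x)"
    and bound: "\<And>x. \<bar>G' x e\<bar> \<le> M"
  shows "integrable lborel (\<lambda>x. G' x e)" "(\<integral>x. G' x e \<partial>lborel) = 0"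
proof -
  define q where "q n x = real (Suc n) * (G (x + (1 / real (Suc n)) *\<^sub>R e) - G x)" for n x
  obtain B where B: "\<And>x. x \<in> S \<Longrightarrow> norm x \<le> B"
    using compact_imp_bounded[OF S(1)] by (auto simp: bounded_iff)
  have cont: "continuous_on UNIV G"
    using der has_derivative_continuous continuous_at_imp_continuous_on by blast
  have Gint: "integrable lborel G"
    by (rule integrable_continuous_on_compact[OF S(1)])
       (use S cont in \<open>auto intro: continuous_on_subset\<close>)
  have [measurable]: "G \<in> borel_measurable borel"
    using cont by (rule borel_measurable_continuous_onI)
  have shift: "integrable lborel (\<lambda>x. G (x + a))" "(\<integral>x. G (x + a) \<partial>lborel) = (\<integral>x. G x \<partial>lborel)" for a
  proof -
    have "integrable (distr lborel borel ((+) a)) G"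
      using Gint by (simp add: lborel_distr_plus)
    then show "integrable lborel (\<lambda>x. G (x + a))"
      by (subst (asm) integrable_distr_eq) (auto simp: add.commute)
    have "(\<integral>x. G x \<partial>lborel) = (\<integral>x. G x \<partial>(distr lborel borel ((+) a)))"
      by (simp add: lborel_distr_plus)
    also have "\<dots> = (\<integral>x. G (x + a) \<partial>lborel)"
      by (subst integral_distr) (auto simp: add.commute)
    finally show "(\<integral>x. G (x + a) \<partial>lborel) = (\<integral>x. G x \<partial>lborel)" by simp
  qed
  have q0: "(\<integral>x. q n x \<partial>lborel) = 0" for n
    unfolding q_def using shift Gint by simp
  have line: "((\<lambda>t. G (x + t *\<^sub>R e)) has_real_derivative G' (x + t *\<^sub>R e) e) (at t)" for x t
  proof -
    have "((\<lambda>t. G (x + t *\<^sub>R e)) has_derivative (\<lambda>s. G' (x + t *\<^sub>R e) (s *\<^sub>R e))) (at t)"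
      by (rule has_derivative_compose[OF _ der]) (auto intro!: derivative_eq_intros)
    moreover have "(\<lambda>s. G' (x + t *\<^sub>R e) (s *\<^sub>R e)) = (*) (G' (x + t *\<^sub>R e) e)"
      using linear_cmul[OF has_derivative_linear[OF der]] by (auto simp: mult.commute)
    ultimately show ?thesis by (simp add: has_field_derivative_def)
  qed
  have lim: "(\<lambda>n. q n x) \<longlonglongrightarrow> G' x e" for x
  proof -
    have "((\<lambda>t. (G (x + t *\<^sub>R e) - G x) / t) \<longlongrightarrow> G' x e) (at 0)"
      using line[of x 0] by (simp add: DERIV_def)
    moreover have "filterlim (\<lambda>n. 1 / real (Suc n)) (at 0) sequentially"
      using LIMSEQ_Suc[OF lim_1_over_n] by (auto simp: filterlim_at)
    ultimately have "(\<lambda>n. (G (x + (1 / real (Suc n)) *\<^sub>R e) - G x) / (1 / real (Suc n))) \<longlonglongrightarrow> G' x e"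
      by (rule filterlim_compose)
    then show ?thesis by (simp add: q_def mult.commute)
  qed
  \<comment> \<open>The mean value theorem turns a difference quotient into a value of the
    derivative, hence the bound \<open>M\<close>. The steps have length at most
    \<open>norm e\<close>, so one ball contains the supports of all \<open>q n\<close>.\<close>
  have dom: "norm (q n x) \<le> indicator (cball 0 (B + norm e)) x *\<^sub>R M" for n x
  proof (cases "x \<in> cball 0 (B + norm e)")
    case True
    obtain z where "G (x + (1 / real (Suc n)) *\<^sub>R e) - G (x + 0 *\<^sub>R e)
        = (1 / real (Suc n) - 0) * G' (x + z *\<^sub>R e) e"
      using MVT2[of 0 "1 / real (Suc n)" "\<lambda>t. G (x + t *\<^sub>R e)" "\<lambda>t. G' (x + t *\<^sub>R e) e"] line
      by auto
    then have "q n x = G' (x + z *\<^sub>R e) e"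
      unfolding q_def by (simp del: of_nat_Suc)
    then show ?thesis using bound True by simp
  next
    case False
    then have "x \<notin> S" using B norm_ge_zero[of e] by (fastforce simp: dist_norm)
    moreover have "x + (1 / real (Suc n)) *\<^sub>R e \<notin> S"
    proof
      assume "x + (1 / real (Suc n)) *\<^sub>R e \<in> S"
      then have "norm (x + (1 / real (Suc n)) *\<^sub>R e) \<le> B" by (rule B)
      moreover have "norm x \<le> norm (x + (1 / real (Suc n)) *\<^sub>R e) + norm ((1 / real (Suc n)) *\<^sub>R e)"
        using norm_triangle_ineq4[of "x + (1 / real (Suc n)) *\<^sub>R e" "(1 / real (Suc n)) *\<^sub>R e"] by simp
      moreover have "norm ((1 / real (Suc n)) *\<^sub>R e) \<le> norm e"
        by (simp add: divide_simps algebra_simps)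
      ultimately show False using False by (auto simp: dist_norm)
    qed
    ultimately have "q n x = 0" using S(2) by (simp add: q_def)
    then show ?thesis using False by simp
  qed
  have dint: "integrable lborel (\<lambda>x. indicator (cball (0::'a) (B + norm e)) x *\<^sub>R M)"
    by (rule borel_integrable_compact) auto
  have qm: "q n \<in> borel_measurable lborel" for n
    unfolding q_def[abs_def] by measurable
  \<comment> \<open>The derivative is not assumed continuous; it is measurable as a pointwise limit
    of the difference quotients.\<close>
  have lm: "(\<lambda>x. G' x e) \<in> borel_measurable lborel"
    by (rule borel_measurable_LIMSEQ_real[OF lim qm])
  show "integrable lborel (\<lambda>x. G' x e)"
    by (rule integrable_dominated_convergence[OF lm _ dint, of q])
       (use lim dom qm in auto)
  have "(\<lambda>n. \<integral>x. q n x \<partial>lborel) \<longlonglongrightarrow> (\<integral>x. G' x e \<partial>lborel)"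
    by (rule integral_dominated_convergence[OF lm _ dint])
       (use lim dom qm in auto)
  then show "(\<integral>x. G' x e \<partial>lborel) = 0"
    by (simp add: q0 LIMSEQ_const_iff)
qed

section \<open>Pointwise calculus for powers of norms and for \<open>Cp\<close>\<close>

text \<open>At the origin the difference quotient is \<open>norm y powr (p - 1)\<close>, which tends
  to 0 exactly because \<open>p > 1\<close>. The formula stays valid there since
  \<open>z \<bullet> h = 0\<close>, even when \<open>p - 2\<close> is negative.\<close>

lemma has_derivative_norm_powr:
  fixes z :: "'a::real_inner"
  assumes p: "1 < p"
  shows "((\<lambda>z. norm z powr p) has_derivative (\<lambda>h. p * norm z powr (p - 2) * (z \<bullet> h))) (at z)"
proof (cases "z = 0")
  case True
  have "((\<lambda>y::'a. norm y powr (p - 1)) \<longlongrightarrow> 0) (at 0)"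
    using p by (auto intro!: tendsto_eq_intros tendsto_powr2)
  moreover have "norm (norm y powr p) / norm y = norm y powr (p - 1)" if "y \<noteq> 0" for y :: 'a
    using that by (simp add: powr_diff)
  ultimately have "((\<lambda>y::'a. norm (norm y powr p) / norm y) \<longlongrightarrow> 0) (at 0)"
    by (subst tendsto_cong[where g = "\<lambda>y. norm y powr (p - 1)"]) (auto simp: eventually_at_filter)
  then show ?thesis
    using True by (simp add: has_derivative_at)
next
  case False
  have "((\<lambda>z. norm z powr p) has_derivative
      (\<lambda>h. norm z powr p * (0 * ln (norm z) + (h \<bullet> sgn z) * p / norm z))) (at z)"
    using False by (intro has_derivative_powr has_derivative_norm) auto
  moreover have "norm z powr p * (0 * ln (norm z) + (h \<bullet> sgn z) * p / norm z)
      = p * norm z powr (p - 2) * (z \<bullet> h)" for h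
  proof -
    have "norm z powr (p - 2) = norm z powr p / (norm z * norm z)"
      using False by (simp add: powr_diff power2_eq_square)
    then show ?thesis using False
      by (simp add: sgn_div_norm inner_commute field_simps)
  qed
  ultimately show ?thesis by simp
qed

lemma normK_nonneg [simp]: "0 \<le> normK K x"
  by (simp add: normK_def sum_nonneg)

text \<open>Replaces the square root by a power of a polynomial, so that the weight can be
  differentiated by the power rule alone.\<close>

lemma normK_powr_eq: "normK K x powr s = (\<Sum>i\<in>K. (x $ i)^2) powr (s / 2)"
  by (simp add: normK_def powr_half_sqrt[symmetric] sum_nonneg powr_powr)

lemma continuous_on_normK [continuous_intros]: "continuous_on A (normK K)"
  unfolding normK_def[abs_def] by (intro continuous_intros)

lemma has_derivative_component [derivative_intros]:
  "((\<lambda>x. x $ i) has_derivative (\<lambda>h. h $ i)) (at (x :: real^'n))"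
  by (rule bounded_linear_imp_has_derivative) (rule bounded_linear_vec_nth)

lemma has_derivative_normK_powr:
  assumes "normK K x \<noteq> 0"
  shows "((\<lambda>x. normK K x powr s) has_derivative
    (\<lambda>h. s * normK K x powr (s - 2) * (\<Sum>i\<in>K. x $ i * h $ i))) (at x)"
proof -
  define Q where "Q = (\<Sum>i\<in>K. (x $ i)^2)"
  have Q: "0 < Q"
    using assms sum_nonneg[of K "\<lambda>i. (x $ i)^2"] by (auto simp: Q_def normK_def less_le)
  have "((\<lambda>x. (\<Sum>i\<in>K. (x $ i)^2) powr (s / 2)) has_derivative
      (\<lambda>h. Q powr (s / 2) * (0 * ln Q + (\<Sum>i\<in>K. 2 * (x $ i * h $ i)) * (s / 2) / Q))) (at x)"
    unfolding Q_def
    by (rule has_derivative_powr)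
       (use Q in \<open>auto simp: Q_def algebra_simps intro!: derivative_eq_intros has_derivative_sum\<close>)
  moreover have "Q powr (s / 2) * (0 * ln Q + (\<Sum>i\<in>K. 2 * (x $ i * h $ i)) * (s / 2) / Q)
      = s * normK K x powr (s - 2) * (\<Sum>i\<in>K. x $ i * h $ i)" for h
  proof -
    have "normK K x powr (s - 2) = Q powr (s / 2 - 1)"
      by (simp add: normK_powr_eq Q_def diff_divide_distrib)
    also have "\<dots> = Q powr (s / 2) / Q"
      using Q by (simp add: powr_diff)
    finally show ?thesis by (simp add: sum_distrib_left[symmetric])
  qed
  ultimately show ?thesis by (simp add: normK_powr_eq)
qed

lemma Re_mult_cnj: "Re (z * cnj w) = z \<bullet> w"
  by (simp add: inner_complex_def)

text \<open>With \<open>\<zeta> = \<beta> z / w\<close> one has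
  \<open>\<xi> - \<eta> = -\<zeta>\<close>, so \<open>|\<xi>|^p\<close> cancels and
  \<open>|\<zeta>|^p - p |\<zeta>|^(p-2) (\<zeta> \<bullet> (\<xi> + \<zeta>))\<close> remains. The
  two multiples of \<open>|\<beta>|^p |z|^p\<close> are kept apart because the second one belongs to
  the divergence.\<close>

lemma norm_powr_minus_Cp:
  fixes z R :: complex
  assumes "\<beta> \<noteq> 0" "z \<noteq> 0" "0 < w"
  defines "\<xi> \<equiv> R / complex_of_real w"
  defines "\<eta> \<equiv> \<xi> + complex_of_real \<beta> * z / complex_of_real w"
  shows "norm \<xi> powr p - Cp p \<xi> \<eta> =
    w powr (-p) * (\<bar>\<beta>\<bar> powr p * norm z powr p
      - p * (\<beta> * \<bar>\<beta>\<bar> powr (p - 2)) * (norm z powr (p - 2) * (z \<bullet> R)) - p * (\<bar>\<beta>\<bar> powr p * norm z powr p))"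
proof -
  define \<zeta> where "\<zeta> = complex_of_real \<beta> * z / complex_of_real w"
  have nz: "norm \<zeta> = \<bar>\<beta>\<bar> * norm z / w"
    using assms(1-3) by (simp add: \<zeta>_def norm_mult norm_divide)
  have z0: "\<zeta> \<noteq> 0" using assms(1-3) by (simp add: \<zeta>_def)
  have in1: "\<zeta> \<bullet> \<xi> = \<beta> * (z \<bullet> R) / w\<^sup>2"
    using assms(1-3) by (simp add: \<zeta>_def \<xi>_def inner_complex_def Re_divide_of_real Im_divide_of_real power2_eq_square field_simps)
  have in2: "norm \<zeta> powr (p - 2) * (\<zeta> \<bullet> \<zeta>) = norm \<zeta> powr p"
    using z0 by (simp add: powr_diff power2_norm_eq_inner)
  have in3: "norm \<zeta> powr (p - 2) * (\<zeta> \<bullet> \<xi>)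
      = w powr (-p) * (\<beta> * \<bar>\<beta>\<bar> powr (p - 2)) * (norm z powr (p - 2) * (z \<bullet> R))"
  proof -
    \<comment> \<open>The factor \<open>w\<^sup>2\<close> is split off to cancel the denominator in
      \<open>in1\<close>.\<close>
    have "norm \<zeta> powr (p - 2) = \<bar>\<beta>\<bar> powr (p - 2) * norm z powr (p - 2) * (w powr (-p) * w\<^sup>2)"
      unfolding nz using assms(1-3) by (simp add: powr_divide powr_mult powr_diff powr_minus divide_simps)
    then show ?thesis using assms(3) by (simp add: in1)
  qed
  have np: "norm \<zeta> powr p = w powr (-p) * (\<bar>\<beta>\<bar> powr p * norm z powr p)"
    unfolding nz using assms(1-3) by (simp add: powr_divide powr_mult powr_minus divide_simps)
  have "norm \<xi> powr p - Cp p \<xi> \<eta> = norm \<zeta> powr p - p * (norm \<zeta> powr (p - 2) * (\<zeta> \<bullet> (\<xi> + \<zeta>)))"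
    using z0 unfolding Cp_def \<eta>_def \<zeta>_def[symmetric] Re_mult_cnj by simp
  also have "\<dots> = norm \<zeta> powr p - p * (norm \<zeta> powr (p - 2) * (\<zeta> \<bullet> \<xi>)) - p * norm \<zeta> powr p"
    unfolding in2[symmetric] by (simp add: inner_add_right algebra_simps)
  finally show ?thesis
    unfolding in3 np by (simp add: algebra_simps)
qed

lemma inner_radderK: "f x \<bullet> radderK K f x = (\<Sum>i\<in>K. x $ i * (f x \<bullet> partial f i x))"
  by (simp add: radderK_def inner_sum_right scaleR_conv_of_real[symmetric])

lemma Lpnorm_weighted:
  "Lpnorm t (\<lambda>x. complex_of_real (normK K x powr s) * f x)
    = (\<integral>x. normK K x powr (s * t) * norm (f x) powr t \<partial>lborel) powr (1 / t)"
  by (simp add: Lpnorm_def norm_mult powr_mult powr_powr)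

section \<open>Test functions, the flux, and the value of the bracket\<close>

context
  fixes K :: "'n::finite set" and f :: "real^'n \<Rightarrow> complex" and S
  assumes f: "f \<in> C0inf_off K"
  defines "S \<equiv> closure {x. f x \<noteq> 0}"
begin

lemma support_compact: "compact S"
  and support_normK: "x \<in> S \<Longrightarrow> normK K x \<noteq> 0"
  and zero_off_support: "x \<notin> S \<Longrightarrow> f x = 0"
  using f closure_subset[of "{x. f x \<noteq> 0}"] by (auto simp: C0inf_off_def S_def)

lemma continuous_test: "continuous_on A f"
  and differentiable_test: "f differentiable (at x)"
  and continuous_partial: "continuous_on A (partial f i)"
proof -
  have "Cm (Suc 0) f" using f unfolding C0inf_off_def by blast
  then show "continuous_on A f" "f differentiable (at x)" "continuous_on A (partial f i)"
    by (auto intro: continuous_on_subset)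
qed

lemma partial_zero_off_support: "x \<notin> S \<Longrightarrow> partial f i x = 0"
proof -
  assume x: "x \<notin> S"
  have "(f has_derivative (\<lambda>h. 0)) (at x)"
    by (rule has_derivative_transform_within_open[of "\<lambda>_. 0" _ _ _ "- S"])
       (use x zero_off_support support_compact in \<open>auto simp: compact_imp_closed open_Compl\<close>)
  then show ?thesis
    by (simp add: partial_def frechet_derivative_at[symmetric])
qed

lemma continuous_norm_powr: "0 < t \<Longrightarrow> continuous_on A (\<lambda>x. norm (f x) powr t)"
  by (intro continuous_on_powr' continuous_intros continuous_test) auto

lemma continuous_normK_powr: "continuous_on S (\<lambda>x. normK K x powr s)"
  using support_normK by (intro continuous_intros) auto

lemma integrable_weighted:
  assumes "0 < t"
  shows "integrable lborel (\<lambda>x. normK K x powr s * norm (f x) powr t)"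
  by (rule integrable_continuous_on_compact[OF support_compact])
     (use assms zero_off_support in
       \<open>auto intro!: continuous_on_mult continuous_norm_powr continuous_normK_powr\<close>)

text \<open>One formula serves every point, including \<open>x' = 0\<close>, where the weight need
  not be differentiable: off the support the flux vanishes locally, and the right-hand side is zero
  because \<open>f x = 0\<close>.\<close>

lemma flux_derivative:
  assumes p: "1 < p"
  shows "((\<lambda>x. x $ i * (normK K x powr s * norm (f x) powr p)) has_derivative
    (\<lambda>h. h $ i * (normK K x powr s * norm (f x) powr p) +
      x $ i * (s * normK K x powr (s - 2) * (\<Sum>j\<in>K. x $ j * h $ j) * norm (f x) powr p +
        normK K x powr s * (p * norm (f x) powr (p - 2) * (f x \<bullet> frechet_derivative f (at x) h))))) (at x)"
    (is "(?G has_derivative ?G') _")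
proof (cases "x \<in> S")
  case True
  have "(f has_derivative frechet_derivative f (at x)) (at x)"
    using differentiable_test frechet_derivative_works by blast
  then have "((\<lambda>x. norm (f x) powr p) has_derivative
      (\<lambda>h. p * norm (f x) powr (p - 2) * (f x \<bullet> frechet_derivative f (at x) h))) (at x)"
    by (rule has_derivative_compose[OF _ has_derivative_norm_powr[OF p]])
  from has_derivative_mult[OF has_derivative_component
      has_derivative_mult[OF has_derivative_normK_powr[OF support_normK[OF True]] this]]
  show ?thesis
    by (rule has_derivative_eq_rhs) (auto simp: algebra_simps)
next
  case False
  have "open (- S)"
    using support_compact by (simp add: compact_imp_closed open_Compl)
  then have "(?G has_derivative (\<lambda>h. 0)) (at x)"
    using False by (intro has_derivative_transform_within_open[OF has_derivative_const, of "- S"])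
       (simp_all add: zero_off_support)
  then show ?thesis using zero_off_support[OF False] by simp
qed

text \<open>\<open>D\<close> is the derivative of the \<open>i\<close>-th flux component along
  \<open>axis i 1\<close>, so its integral vanishes once it is known to be uniformly
  bounded.\<close>

lemma integral_flux_divergence:
  fixes s :: real
  assumes p: "1 < p" and i: "i \<in> K"
  defines "D \<equiv> \<lambda>x. normK K x powr s * norm (f x) powr p +
      x $ i * (s * normK K x powr (s - 2) * x $ i * norm (f x) powr p +
        normK K x powr s * (p * norm (f x) powr (p - 2) * (f x \<bullet> partial f i x)))"
  shows "integrable lborel D" "integral\<^sup>L lborel D = 0"
proof -
  \<comment> \<open>A majorant of \<open>|D|\<close>: by Cauchy-Schwarz the inner product supplies a
    factor \<open>norm (f x)\<close>, which raises the possibly negative exponent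
    \<open>p - 2\<close> to \<open>p - 1 > 0\<close>. Hence \<open>B\<close> is continuous, and so
    bounded, on the compact support.\<close>
  define B where "B x = normK K x powr s * norm (f x) powr p +
      \<bar>x $ i\<bar> * (\<bar>s\<bar> * normK K x powr (s - 2) * \<bar>x $ i\<bar> * norm (f x) powr p +
        normK K x powr s * (p * (norm (f x) powr (p - 1) * norm (partial f i x))))" for x
  have ax: "(\<Sum>j\<in>K. x $ j * axis i 1 $ j) = x $ i" for x :: "real^'n"
  proof -
    have "x $ j * axis i 1 $ j = (if j = i then x $ i else 0)" for j
      by (simp add: axis_def)
    then show ?thesis using i by simp
  qed
  have D: "(axis i 1 :: real^'n) $ i * (normK K x powr s * norm (f x) powr p) +
      x $ i * (s * normK K x powr (s - 2) * (\<Sum>j\<in>K. x $ j * axis i 1 $ j) * norm (f x) powr p +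
        normK K x powr s * (p * norm (f x) powr (p - 2) * (f x \<bullet> frechet_derivative f (at x) (axis i 1)))) = D x" for x
    unfolding D_def ax partial_def by (simp only: axis_nth mult_1)
  have "continuous_on S B"
    unfolding B_def[abs_def]
    using p
    by (intro continuous_on_add continuous_on_mult continuous_on_const continuous_on_rabs
        continuous_on_norm continuous_on_component continuous_on_id continuous_norm_powr
        continuous_normK_powr continuous_partial) auto
  then have "bounded (B ` S)"
    using support_compact by (intro compact_imp_bounded compact_continuous_image)
  then obtain M where M: "\<And>x. x \<in> S \<Longrightarrow> \<bar>B x\<bar> \<le> M"
    by (auto simp: bounded_iff)
  have DB: "\<bar>D x\<bar> \<le> B x" for x
  proof -
    have "norm (f x) powr (p - 2) * \<bar>f x \<bullet> partial f i x\<bar>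
        \<le> norm (f x) powr (p - 2) * (norm (f x) * norm (partial f i x))"
      by (intro mult_left_mono Cauchy_Schwarz_ineq2) auto
    also have "\<dots> = norm (f x) powr (p - 1) * norm (partial f i x)"
    proof (cases "f x = 0")
      case False
      then have "norm (f x) powr (p - 2) * norm (f x) = norm (f x) powr (p - 1)"
        using powr_add[of "norm (f x)" "p - 2" 1] by simp
      then show ?thesis by (metis mult.assoc)
    qed simp
    finally have "\<bar>p * norm (f x) powr (p - 2) * (f x \<bullet> partial f i x)\<bar>
        \<le> p * (norm (f x) powr (p - 1) * norm (partial f i x))"
      using p by (simp add: abs_mult mult.assoc)
    then have "\<bar>normK K x powr s * (p * norm (f x) powr (p - 2) * (f x \<bullet> partial f i x))\<bar>
        \<le> normK K x powr s * (p * (norm (f x) powr (p - 1) * norm (partial f i x)))"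
      unfolding abs_mult[of "normK K x powr s"] by (simp add: mult_left_mono)
    then have "\<bar>s * normK K x powr (s - 2) * x $ i * norm (f x) powr p +
          normK K x powr s * (p * norm (f x) powr (p - 2) * (f x \<bullet> partial f i x))\<bar>
        \<le> \<bar>s\<bar> * normK K x powr (s - 2) * \<bar>x $ i\<bar> * norm (f x) powr p +
          normK K x powr s * (p * (norm (f x) powr (p - 1) * norm (partial f i x)))"
      by (intro order_trans[OF abs_triangle_ineq] add_mono) (simp_all add: abs_mult)
    then show ?thesis
      unfolding D_def B_def
      by (intro order_trans[OF abs_triangle_ineq] add_mono)
         (simp_all only: abs_mult[of "x $ i"] mult_left_mono abs_ge_zero, simp)
  qed
  have bound: "\<bar>D x\<bar> \<le> max M 0" for x
  proof (cases "x \<in> S")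
    case True
    then show ?thesis using M[of x] DB[of x] by linarith
  next
    case False
    then show ?thesis using zero_off_support by (simp add: D_def)
  qed
  note * = integral_directional_derivative_eq_0[OF support_compact _ flux_derivative[OF p, of i s],
      where e = "axis i 1" and M = "max M 0", unfolded D]
  show "integrable lborel D" by (rule *(1)) (use bound zero_off_support in auto)
  show "integral\<^sup>L lborel D = 0" by (rule *(2)) (use bound zero_off_support in auto)
qed

lemma bracket_eq:
  fixes \<alpha> :: real
  assumes p: "1 < p"
  defines "\<beta> \<equiv> (real (card K) - \<alpha>) / p"
  shows "bracket K p \<alpha> f = \<bar>\<beta>\<bar> powr p * (\<integral>x. normK K x powr (-\<alpha>) * norm (f x) powr p \<partial>lborel)"
proof -
  define H where "H x = normK K x powr (-\<alpha>) * norm (f x) powr p" for x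
  define D where "D i x = normK K x powr (-\<alpha>) * norm (f x) powr p +
      x $ i * (-\<alpha> * normK K x powr (-\<alpha> - 2) * x $ i * norm (f x) powr p +
        normK K x powr (-\<alpha>) * (p * norm (f x) powr (p - 2) * (f x \<bullet> partial f i x)))" for i x
  define \<xi> where "\<xi> x = radderK K f x / complex_of_real (normK K x powr (\<alpha> / p))" for x
  define \<eta> where "\<eta> x = \<xi> x + complex_of_real \<beta> * f x / complex_of_real (normK K x powr (\<alpha> / p))" for x
  have Dint: "integrable lborel (D i)" "integral\<^sup>L lborel (D i) = 0" if "i \<in> K" for i
    using integral_flux_divergence[OF p that, of "-\<alpha>"] by (simp_all add: D_def[abs_def])
  have Hint: "integrable lborel H"
    using integrable_weighted[of p "-\<alpha>"] p by (simp add: H_def[abs_def])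
  have \<xi>int: "integrable lborel (\<lambda>x. norm (\<xi> x) powr p)"
  proof (rule integrable_continuous_on_compact[OF support_compact])
    show "continuous_on S (\<lambda>x. norm (\<xi> x) powr p)"
      unfolding \<xi>_def radderK_def
      using p support_normK
      by (intro continuous_on_powr' continuous_on_norm continuous_on_divide continuous_on_sum
          continuous_on_mult continuous_on_of_real continuous_on_component continuous_on_id
          continuous_partial continuous_normK_powr continuous_on_const) auto
    show "norm (\<xi> x) powr p = 0" if "x \<notin> S" for x
      using partial_zero_off_support[OF that] by (simp add: \<xi>_def radderK_def)
  qed
  \<comment> \<open>Summing over \<open>K\<close>, the undifferentiated terms give
    \<open>card K\<close>, while the squares \<open>(x $ i)\<^sup>2\<close> add up to
    \<open>|x'|^2\<close> and restore the exponent \<open>-\<alpha>\<close>. This is the origin of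
    \<open>k - \<alpha>\<close>.\<close>
  have div: "(\<Sum>i\<in>K. D i x) = (real (card K) - \<alpha>) * H x +
      normK K x powr (-\<alpha>) * (p * norm (f x) powr (p - 2) * (f x \<bullet> radderK K f x))" if "x \<in> S" for x
  proof -
    have "(\<Sum>i\<in>K. (x $ i)\<^sup>2) = (normK K x)\<^sup>2"
      by (simp add: normK_def sum_nonneg)
    moreover have "normK K x powr (-\<alpha> - 2) * (normK K x)\<^sup>2 = normK K x powr (-\<alpha>)"
      using support_normK[OF that] by (simp add: powr_diff)
    moreover have "(\<Sum>i\<in>K. D i x) = real (card K) * H x
        + (-\<alpha> * normK K x powr (-\<alpha> - 2) * norm (f x) powr p) * (\<Sum>i\<in>K. (x $ i)\<^sup>2)
        + (normK K x powr (-\<alpha>) * (p * norm (f x) powr (p - 2))) * (\<Sum>i\<in>K. x $ i * (f x \<bullet> partial f i x))"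
    proof -
      have "D i x = H x + (-\<alpha> * normK K x powr (-\<alpha> - 2) * norm (f x) powr p) * (x $ i)\<^sup>2 +
          (normK K x powr (-\<alpha>) * (p * norm (f x) powr (p - 2))) * (x $ i * (f x \<bullet> partial f i x))" for i
        by (simp add: D_def H_def algebra_simps power2_eq_square)
      then show ?thesis
        by (simp only: sum.distrib sum_distrib_left[symmetric] sum_constant)
    qed
    ultimately show ?thesis
      unfolding inner_radderK H_def by algebra
  qed
  have point: "norm (\<xi> x) powr p - Cp p (\<xi> x) (\<eta> x)
      = \<bar>\<beta>\<bar> powr p * H x - \<beta> * \<bar>\<beta>\<bar> powr (p - 2) * (\<Sum>i\<in>K. D i x)" for x
  \<comment> \<open>In the degenerate case \<open>\<xi> = \<eta>\<close>, so \<open>Cp\<close>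
    equals \<open>|\<xi>|^p\<close> by its convention and both sides are zero.\<close>
  proof (cases "\<beta> = 0 \<or> f x = 0")
    case True
    then show ?thesis by (auto simp: Cp_def \<eta>_def H_def D_def)
  next
    case False
    then have x: "x \<in> S" using zero_off_support by blast
    define w where "w = normK K x powr (\<alpha> / p)"
    have w: "0 < w" using support_normK[OF x] by (simp add: w_def)
    have wp: "w powr (-p) = normK K x powr (-\<alpha>)"
      using p by (simp add: w_def powr_powr)
    have b2: "\<beta> * \<beta> * \<bar>\<beta>\<bar> powr (p - 2) = \<bar>\<beta>\<bar> powr p"
      using False by (simp add: powr_diff power2_eq_square)
    have k: "real (card K) - \<alpha> = p * \<beta>"
      using p by (simp add: \<beta>_def)
    have "norm (\<xi> x) powr p - Cp p (\<xi> x) (\<eta> x) =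
        normK K x powr (-\<alpha>) * (\<bar>\<beta>\<bar> powr p * norm (f x) powr p
          - p * (\<beta> * \<bar>\<beta>\<bar> powr (p - 2)) * (norm (f x) powr (p - 2) * (f x \<bullet> radderK K f x))
          - p * (\<bar>\<beta>\<bar> powr p * norm (f x) powr p))"
      unfolding \<eta>_def \<xi>_def w_def[symmetric] wp[symmetric]
      using False w by (intro norm_powr_minus_Cp) auto
    also have "\<dots> = \<bar>\<beta>\<bar> powr p * H x - \<beta> * \<bar>\<beta>\<bar> powr (p - 2) * (\<Sum>i\<in>K. D i x)"
      unfolding div[OF x] k H_def b2[symmetric] by (simp add: algebra_simps)
    finally show ?thesis .
  qed
  have sumint: "integrable lborel (\<lambda>x. \<Sum>i\<in>K. D i x)" "(\<integral>x. (\<Sum>i\<in>K. D i x) \<partial>lborel) = 0"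
    using Dint by (auto intro!: Bochner_Integration.integrable_sum simp: Bochner_Integration.integral_sum)
  \<comment> \<open>Solved for \<open>Cp\<close>, the pointwise identity also yields its
    integrability, with no separate estimate of \<open>Cp\<close>.\<close>
  have Cp: "Cp p (\<xi> x) (\<eta> x) = norm (\<xi> x) powr p -
      (\<bar>\<beta>\<bar> powr p * H x - \<beta> * \<bar>\<beta>\<bar> powr (p - 2) * (\<Sum>i\<in>K. D i x))" for x
    using point[of x] by linarith
  have "(\<integral>x. Cp p (\<xi> x) (\<eta> x) \<partial>lborel)
      = (\<integral>x. norm (\<xi> x) powr p \<partial>lborel) - \<bar>\<beta>\<bar> powr p * (\<integral>x. H x \<partial>lborel)"
    unfolding Cp using \<xi>int Hint sumint
    by (subst Bochner_Integration.integral_diff) auto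
  moreover have "Lpnorm p \<xi> powr p = (\<integral>x. norm (\<xi> x) powr p \<partial>lborel)"
    using p by (simp add: Lpnorm_def powr_powr integral_nonneg_AE)
  ultimately show ?thesis
    by (simp add: bracket_def Let_def \<xi>_def[abs_def] \<eta>_def[abs_def] \<beta>_def H_def[abs_def])
qed

text \<open>Otherwise the nonempty open set where \<open>f\<close> is nonzero would be a null set,
  since the weight is positive there. Sharpness needs this: a strictly larger constant gives a
  strict inequality only if the norm is positive.\<close>

lemma weighted_integral_pos:
  assumes "0 < t" "f x0 \<noteq> 0"
  shows "0 < (\<integral>x. normK K x powr s * norm (f x) powr t \<partial>lborel)"
proof (rule ccontr)
  assume "\<not> ?thesis"
  moreover have "0 \<le> (\<integral>x. normK K x powr s * norm (f x) powr t \<partial>lborel)"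
    by (simp add: integral_nonneg_AE)
  ultimately have "(\<integral>x. normK K x powr s * norm (f x) powr t \<partial>lborel) = 0"
    by linarith
  then have "AE x in lborel. normK K x powr s * norm (f x) powr t = 0"
    using integral_nonneg_eq_0_iff_AE[OF integrable_weighted[OF assms(1)]] by simp
  then have ae: "AE x in lborel. x \<notin> {x. f x \<noteq> 0}"
    by (rule eventually_mono) (use support_normK zero_off_support in auto)
  have op: "open {x. f x \<noteq> 0}"
    using open_Collect_neq[OF continuous_test continuous_on_const] .
  then have "{x. f x \<noteq> 0} \<in> null_sets lborel"
    using ae by (subst AE_iff_null_sets) auto
  then have "negligible {x. f x \<noteq> 0}"
    by (auto simp: negligible_iff_null_sets intro: null_sets_completionI)
  then show False
    using open_not_negligible[OF op] assms(2) by auto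
qed

end

section \<open>Existence of a nonzero test function\<close>

text \<open>The power in the denominator makes the span of the family closed under differentiation,
  starting from the classical \<open>exp (-1/t)\<close>.\<close>

definition flat :: "nat \<Rightarrow> real \<Rightarrow> real" where
  "flat j t = (if 0 < t then exp (- 1 / t) / t ^ j else 0)"

lemma flat_tendsto_0: "(flat j \<longlongrightarrow> 0) (at 0)"
proof (rule filterlim_split_at)
  have "eventually (\<lambda>t. flat j t = 0) (at_left 0)"
    by (auto simp: flat_def eventually_at_filter)
  then show "(flat j \<longlongrightarrow> 0) (at_left 0)"
    by (rule tendsto_eventually)
  have "((\<lambda>t. inverse t ^ j / exp (inverse t)) \<longlongrightarrow> (0::real)) (at_right 0)"
    by (rule filterlim_compose[OF tendsto_power_div_exp_0 filterlim_inverse_at_top_right])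
  moreover have "eventually (\<lambda>t. inverse t ^ j / exp (inverse t) = flat j t) (at_right 0)"
    by (auto simp: flat_def eventually_at_filter exp_minus field_simps)
  ultimately show "(flat j \<longlongrightarrow> 0) (at_right 0)"
    by (rule Lim_transform_eventually)
qed

lemma flat_DERIV: "(flat j has_real_derivative flat (j + 2) t - real j * flat (j + 1) t) (at t)"
proof -
  consider "t < 0" | "t = 0" | "0 < t" by linarith
  then show ?thesis
  proof cases
    case 1
    have "(flat j has_real_derivative 0) (at t)"
      by (rule has_field_derivative_transform_within_open[of "\<lambda>_. 0" _ _ "{..<0}"])
         (use 1 in \<open>auto simp: flat_def\<close>)
    then show ?thesis using 1 by (simp add: flat_def)
  next
    case 2
    \<comment> \<open>The quotient at 0 is itself a member of the family, with \<open>j\<close>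
      raised by one, so the limit already proved applies.\<close>
    have "((\<lambda>h. flat j h / h) \<longlongrightarrow> 0) (at 0)"
      by (rule Lim_transform_eventually[OF flat_tendsto_0[of "Suc j"]])
         (auto simp: flat_def eventually_at_filter field_simps)
    then show ?thesis
      using 2 by (simp add: DERIV_def flat_def[of _ 0])
  next
    case 3
    have "((\<lambda>t. exp (- 1 / t) / t ^ j) has_real_derivative
        flat (j + 2) t - real j * flat (j + 1) t) (at t)"
    proof -
      have "((\<lambda>t. exp (- 1 / t)) has_real_derivative exp (- 1 / t) / t\<^sup>2) (at t)"
        using 3 by (auto intro!: derivative_eq_intros simp: power2_eq_square)
      moreover have "((\<lambda>t. t ^ j) has_real_derivative real j * t ^ j / t) (at t)"
        by (rule DERIV_cong[OF DERIV_pow]) (use 3 in \<open>cases j; auto\<close>)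
      ultimately show ?thesis
        by (rule DERIV_cong[OF DERIV_divide])
           (use 3 in \<open>auto simp: flat_def power2_eq_square field_simps\<close>)
    qed
    then show ?thesis
      by (rule has_field_derivative_transform_within_open[of _ _ _ "{0<..}"])
         (use 3 in \<open>auto simp: flat_def\<close>)
  qed
qed

text \<open>A class containing a bump function and closed under partial derivatives.\<close>

inductive bump_algebra :: "real \<Rightarrow> real^'n::finite \<Rightarrow> (real^'n \<Rightarrow> complex) \<Rightarrow> bool" for \<rho> a where
  base: "bump_algebra \<rho> a (\<lambda>x. complex_of_real (flat j (\<rho> - (x - a) \<bullet> (x - a))))"
| scale: "bump_algebra \<rho> a g \<Longrightarrow> bump_algebra \<rho> a (\<lambda>x. complex_of_real c * g x)"
| coord: "bump_algebra \<rho> a g \<Longrightarrow> bump_algebra \<rho> a (\<lambda>x. complex_of_real ((x - a) $ i) * g x)"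
| add: "bump_algebra \<rho> a g \<Longrightarrow> bump_algebra \<rho> a h \<Longrightarrow> bump_algebra \<rho> a (\<lambda>x. g x + h x)"

lemma partial_eqI: "(g has_derivative g') (at x) \<Longrightarrow> partial g i x = g' (axis i 1)"
  by (simp add: partial_def frechet_derivative_at[symmetric])

text \<open>The gradient of \<open>\<rho> - |x - a|^2\<close> is \<open>-2 (x - a)\<close>, so
  multiplication by constants and by centred coordinates is all that the chain rule demands;
  products of two general members never arise.\<close>

lemma bump_algebra_partial:
  assumes "bump_algebra \<rho> a g"
  shows "(\<forall>x. g differentiable (at x)) \<and> (\<forall>i. bump_algebra \<rho> a (partial g i))"
  using assms
proof induction
  case (base j)
  let ?u = "\<lambda>x. \<rho> - (x - a) \<bullet> (x - a)"
  let ?d = "\<lambda>x. flat (j + 2) (?u x) - real j * flat (j + 1) (?u x)"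
  have der: "((\<lambda>x. complex_of_real (flat j (?u x))) has_derivative
      (\<lambda>h. complex_of_real (?d x * (- 2 * ((x - a) \<bullet> h))))) (at x)" for x
  proof -
    have "(?u has_derivative (\<lambda>h. - 2 * ((x - a) \<bullet> h))) (at x)"
      by (auto intro!: derivative_eq_intros simp: inner_commute)
    from has_derivative_compose[OF this flat_DERIV[unfolded has_field_derivative_def]]
    show ?thesis by (rule has_derivative_of_real)
  qed
  have "partial (\<lambda>x. complex_of_real (flat j (?u x))) i = (\<lambda>x. complex_of_real ((x - a) $ i) *
      (complex_of_real (- 2) * complex_of_real (flat (j + 2) (?u x)) +
       complex_of_real (2 * real j) * complex_of_real (flat (j + 1) (?u x))))" for i
    by (rule ext, subst partial_eqI[OF der])
       (simp only: inner_axis of_real_mult[symmetric] of_real_add[symmetric], simp add: algebra_simps)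
  then show ?case
    using der by (auto simp only: differentiable_def intro!: bump_algebra.intros)
next
  case (scale g c)
  have der: "((\<lambda>x. complex_of_real c * g x) has_derivative
      (\<lambda>h. complex_of_real c * frechet_derivative g (at x) h)) (at x)" for x
    using scale frechet_derivative_works by (blast intro: has_derivative_mult_right)
  have "partial (\<lambda>x. complex_of_real c * g x) i = (\<lambda>x. complex_of_real c * partial g i x)" for i
    by (rule ext, subst partial_eqI[OF der]) (simp add: partial_def)
  then show ?case
    using der scale by (auto simp only: differentiable_def intro!: bump_algebra.intros)
next
  case (coord g k)
  have der: "((\<lambda>x. complex_of_real ((x - a) $ k) * g x) has_derivative
      (\<lambda>h. complex_of_real ((x - a) $ k) * frechet_derivative g (at x) h + complex_of_real (h $ k) * g x)) (at x)" for x
  proof -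
    have "(g has_derivative frechet_derivative g (at x)) (at x)"
      using coord frechet_derivative_works by blast
    moreover have "((\<lambda>x. (x - a) $ k) has_derivative (\<lambda>h. h $ k)) (at x)"
      by (auto intro!: derivative_eq_intros has_derivative_component)
    ultimately show ?thesis
      by (intro has_derivative_mult has_derivative_of_real)
  qed
  have "partial (\<lambda>x. complex_of_real ((x - a) $ k) * g x) i =
      (\<lambda>x. complex_of_real ((x - a) $ k) * partial g i x + complex_of_real (axis i 1 $ k) * g x)" for i
    by (rule ext, subst partial_eqI[OF der]) (simp add: partial_def)
  then show ?case
    using der coord by (auto simp only: differentiable_def intro!: bump_algebra.intros)
next
  case (add g h)
  have der: "((\<lambda>x. g x + h x) has_derivative
      (\<lambda>y. frechet_derivative g (at x) y + frechet_derivative h (at x) y)) (at x)" for x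
    using add frechet_derivative_works by (blast intro: has_derivative_add)
  have "partial (\<lambda>x. g x + h x) i = (\<lambda>x. partial g i x + partial h i x)" for i
    by (rule ext, subst partial_eqI[OF der]) (simp add: partial_def)
  then show ?case
    using der add by (auto simp only: differentiable_def intro!: bump_algebra.intros)
qed

lemma bump_algebra_Cm: "bump_algebra \<rho> a g \<Longrightarrow> Cm m g"
proof (induction m arbitrary: g)
  case 0
  then show ?case
    using bump_algebra_partial[OF 0]
    by (auto intro!: continuous_at_imp_continuous_on differentiable_imp_continuous_within)
next
  case (Suc m)
  then show ?case
    using bump_algebra_partial[OF Suc.prems]
    by (auto intro!: continuous_at_imp_continuous_on differentiable_imp_continuous_within)
qed

lemma C0inf_off_nontrivial:
  fixes K :: "'n::finite set"
  assumes "K \<noteq> {}"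
  obtains f x0 where "f \<in> C0inf_off K" "f x0 \<noteq> 0"
proof -
  \<comment> \<open>Every coordinate hyperplane has distance 1 from the all-ones vector, so a ball
    of radius 1/2 (hence \<open>1 / 4\<close> below) avoids \<open>x' = 0\<close> for every nonempty
    \<open>K\<close>.\<close>
  define a :: "real^'n" where "a = (\<chi> i. 1)"
  define f where "f x = complex_of_real (flat 0 (1 / 4 - (x - a) \<bullet> (x - a)))" for x
  have "{x. f x \<noteq> 0} \<subseteq> cball a (1 / 2)"
  proof
    fix x assume "x \<in> {x. f x \<noteq> 0}"
    then have "(norm (x - a))\<^sup>2 \<le> (1 / 2)\<^sup>2"
      by (auto simp: f_def flat_def dot_square_norm power_divide split: if_splits)
    then have "norm (x - a) \<le> 1 / 2"
      by (rule power2_le_imp_le) simp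
    then show "x \<in> cball a (1 / 2)"
      by (simp add: dist_norm norm_minus_commute)
  qed
  then have sub: "closure {x. f x \<noteq> 0} \<subseteq> cball a (1 / 2)"
    by (rule closure_minimal) simp
  moreover have "compact (closure {x. f x \<noteq> 0})"
    using sub by (meson bounded_cball bounded_subset closed_closure compact_eq_bounded_closed)
  moreover have "normK K x \<noteq> 0" if "x \<in> cball a (1 / 2)" for x
  proof
    assume "normK K x = 0"
    then have z: "\<forall>i\<in>K. x $ i = 0"
      by (simp add: normK_def sum_nonneg_eq_0_iff)
    obtain i where "i \<in> K" using assms by blast
    then have "\<bar>(a - x) $ i\<bar> = 1" using z by (simp add: a_def)
    then show False
      using that component_le_norm_cart[of "a - x" i] by (simp add: dist_norm)
  qed
  moreover have "Cm m f" for m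
    unfolding f_def[abs_def] by (rule bump_algebra_Cm) (rule bump_algebra.base)
  ultimately have "f \<in> C0inf_off K"
    by (auto simp: C0inf_off_def)
  moreover have "f a \<noteq> 0"
    by (simp add: f_def flat_def)
  ultimately show ?thesis by (rule that)
qed

section \<open>The inequality and its sharpness\<close>

text \<open>Separates the constant from the norm in the bracket factor. With \<open>rpow\<close>
  this persists at \<open>\<delta> = 0\<close>, where every factor is 1, even for base zero, whereas
  \<open>0 powr 0 = 0\<close>.\<close>

lemma rpow_powr_mult:
  assumes "0 < p" "0 \<le> x" "0 \<le> U"
  shows "rpow (x powr p * U) (\<delta> / p) = rpow x \<delta> * rpow (U powr (1 / p)) \<delta>"
  using assms by (simp add: rpow_def powr_mult powr_powr)

theorem theorem5p1:
  fixes K :: "'n::finite set"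
    and p q r \<delta> \<alpha> b c :: real
  assumes K: "K \<noteq> {}"
    and p: "1 < p" and q: "1 < q" and r: "0 < r" and pqr: "p + q \<ge> r"
    and \<delta>01: "0 \<le> \<delta>" "\<delta> \<le> 1"
    and \<delta>rng: "(r - q) / r \<le> \<delta>" "\<delta> \<le> p / r"
    and bal: "\<delta> * r / p + (1 - \<delta>) * r / q = 1"
    and cdef: "c = - \<delta> + b * (1 - \<delta>)"
  shows "(\<forall>f \<in> C0inf_off K.
            0 \<le> bracket K p \<alpha> f \<and>
            rpow \<bar>(real (card K) - \<alpha>) / p\<bar> \<delta> *
              Lpnorm r (\<lambda>x. complex_of_real (normK K x powr (\<alpha> * c / p)) * f x)
            \<le> rpow (bracket K p \<alpha> f) (\<delta> / p) *
              rpow (Lpnorm q (\<lambda>x. complex_of_real (normK K x powr (\<alpha> * b / p)) * f x)) (1 - \<delta>))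
       \<and> (\<alpha> \<noteq> real (card K) \<and> ((q = p \<and> b = -1) \<or> \<delta> = 0 \<or> \<delta> = 1) \<longrightarrow>
           (\<forall>C. C > rpow \<bar>(real (card K) - \<alpha>) / p\<bar> \<delta> \<longrightarrow>
              (\<exists>f \<in> C0inf_off K.
                 C * Lpnorm r (\<lambda>x. complex_of_real (normK K x powr (\<alpha> * c / p)) * f x)
                 > rpow (bracket K p \<alpha> f) (\<delta> / p) *
                   rpow (Lpnorm q (\<lambda>x. complex_of_real (normK K x powr (\<alpha> * b / p)) * f x)) (1 - \<delta>))))"
proof -
  define \<beta> where "\<beta> = (real (card K) - \<alpha>) / p"
  define I where "I s t f = (\<integral>x. normK K x powr s * norm (f x) powr t \<partial>lborel)"
    for s t and f :: "real^'n \<Rightarrow> complex"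
  have I0: "0 \<le> I s t f" for s t f
    unfolding I_def by (simp add: integral_nonneg_AE)
  have br: "bracket K p \<alpha> f = \<bar>\<beta>\<bar> powr p * I (-\<alpha>) p f" if "f \<in> C0inf_off K" for f
    using bracket_eq[OF that p] by (simp add: I_def \<beta>_def)
  have rhs: "rpow (bracket K p \<alpha> f) (\<delta> / p) = rpow \<bar>\<beta>\<bar> \<delta> * rpow (I (-\<alpha>) p f powr (1 / p)) \<delta>"
    if "f \<in> C0inf_off K" for f
    unfolding br[OF that] using p I0 by (intro rpow_powr_mult) auto
  have Lp: "Lpnorm t (\<lambda>x. complex_of_real (normK K x powr s) * f x) = I (s * t) t f powr (1 / t)"
    for s t and f :: "real^'n \<Rightarrow> complex"
    unfolding I_def by (rule Lpnorm_weighted)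
  \<comment> \<open>At the endpoints the balance condition makes the two sides of the interpolation
    the same quantity. They are treated apart because Hoelder is available only for
    \<open>0 < \<theta> < 1\<close>.\<close>
  have ends0: "r = q" "c = b" if "\<delta> = 0"
    using that bal q cdef by (auto simp: field_simps)
  have ends1: "r = p" "c = -1" if "\<delta> = 1"
    using that bal p cdef by (auto simp: field_simps)
  have interp: "I (\<alpha> * c / p * r) r f powr (1 / r)
      \<le> rpow (I (-\<alpha>) p f powr (1 / p)) \<delta> * rpow (I (\<alpha> * b / p * q) q f powr (1 / q)) (1 - \<delta>)"
    if f: "f \<in> C0inf_off K" for f
  proof -
    consider "\<delta> = 0" | "\<delta> = 1" | "0 < \<delta>" "\<delta> < 1" using \<delta>01 by linarith
    then show ?thesis
    proof cases
      case 1
      then show ?thesis using ends0 by (simp add: rpow_def)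
    next
      case 2
      then show ?thesis using ends1 p by (simp add: rpow_def)
    next
      case 3
      \<comment> \<open>The two summands of the balance condition are precisely the Hoelder weights
        \<open>\<theta>\<close> and \<open>1 - \<theta>\<close>.\<close>
      define \<theta> where "\<theta> = \<delta> * r / p"
      have \<theta>': "1 - \<theta> = (1 - \<delta>) * r / q" using bal by (simp add: \<theta>_def)
      have "0 < \<theta>" using 3 p r by (simp add: \<theta>_def)
      moreover have "0 < 1 - \<theta>" unfolding \<theta>' using 3 q r by simp
      ultimately have \<theta>: "0 < \<theta>" "\<theta> < 1" by auto
      \<comment> \<open>The definition of \<open>c\<close> is what makes the powers of
        \<open>|x'|\<close> match; \<open>e2\<close> does the same for the powers of
        \<open>|f|\<close>.\<close>
      have e1: "-\<alpha> * \<theta> + \<alpha> * b / p * q * (1 - \<theta>) = \<alpha> * c / p * r"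
        unfolding \<theta>' unfolding \<theta>_def cdef using p q by (simp add: field_simps)
      have e2: "p * \<theta> + q * (1 - \<theta>) = r"
        unfolding \<theta>' unfolding \<theta>_def using p q by (simp add: field_simps)
      have "I (\<alpha> * c / p * r) r f = (\<integral>x. (normK K x powr (-\<alpha>) * norm (f x) powr p) powr \<theta> *
          (normK K x powr (\<alpha> * b / p * q) * norm (f x) powr q) powr (1 - \<theta>) \<partial>lborel)"
        unfolding I_def
      proof (rule Bochner_Integration.integral_cong[OF refl])
        fix x
        have "(normK K x powr (-\<alpha>) * norm (f x) powr p) powr \<theta> *
            (normK K x powr (\<alpha> * b / p * q) * norm (f x) powr q) powr (1 - \<theta>)
          = (normK K x powr (-\<alpha> * \<theta>) * normK K x powr (\<alpha> * b / p * q * (1 - \<theta>))) *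
            (norm (f x) powr (p * \<theta>) * norm (f x) powr (q * (1 - \<theta>)))"
          by (simp add: powr_mult powr_powr)
        then show "normK K x powr (\<alpha> * c / p * r) * norm (f x) powr r =
            (normK K x powr (-\<alpha>) * norm (f x) powr p) powr \<theta> *
            (normK K x powr (\<alpha> * b / p * q) * norm (f x) powr q) powr (1 - \<theta>)"
          by (simp only: powr_add[symmetric] e1 e2)
      qed
      also have "\<dots> \<le> I (-\<alpha>) p f powr \<theta> * I (\<alpha> * b / p * q) q f powr (1 - \<theta>)"
        unfolding I_def using p q \<theta>
        by (intro integral_powr_interpolation integrable_weighted[OF f]) auto
      finally have "I (\<alpha> * c / p * r) r f powr (1 / r)
          \<le> (I (-\<alpha>) p f powr \<theta> * I (\<alpha> * b / p * q) q f powr (1 - \<theta>)) powr (1 / r)"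
        using r I0 by (intro powr_mono2) auto
      also have "\<dots> = I (-\<alpha>) p f powr (\<delta> / p) * I (\<alpha> * b / p * q) q f powr ((1 - \<delta>) / q)"
        unfolding \<theta>' using r by (simp add: \<theta>_def powr_mult powr_powr)
      finally show ?thesis
        using 3 by (simp add: rpow_def powr_powr)
    qed
  qed
  have lower: "0 \<le> bracket K p \<alpha> f \<and>
      rpow \<bar>(real (card K) - \<alpha>) / p\<bar> \<delta> *
        Lpnorm r (\<lambda>x. complex_of_real (normK K x powr (\<alpha> * c / p)) * f x)
      \<le> rpow (bracket K p \<alpha> f) (\<delta> / p) *
        rpow (Lpnorm q (\<lambda>x. complex_of_real (normK K x powr (\<alpha> * b / p)) * f x)) (1 - \<delta>)"
    if f: "f \<in> C0inf_off K" for f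
  proof
    show "0 \<le> bracket K p \<alpha> f"
      unfolding br[OF f] using I0 by simp
    have "0 \<le> rpow \<bar>\<beta>\<bar> \<delta>" by (simp add: rpow_def)
    then show "rpow \<bar>(real (card K) - \<alpha>) / p\<bar> \<delta> *
        Lpnorm r (\<lambda>x. complex_of_real (normK K x powr (\<alpha> * c / p)) * f x)
      \<le> rpow (bracket K p \<alpha> f) (\<delta> / p) *
        rpow (Lpnorm q (\<lambda>x. complex_of_real (normK K x powr (\<alpha> * b / p)) * f x)) (1 - \<delta>)"
      unfolding rhs[OF f] Lp \<beta>_def[symmetric] mult.assoc
      by (intro mult_left_mono interp[OF f])
  qed
  have sharp: "\<exists>f \<in> C0inf_off K.
      C * Lpnorm r (\<lambda>x. complex_of_real (normK K x powr (\<alpha> * c / p)) * f x)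
      > rpow (bracket K p \<alpha> f) (\<delta> / p) *
        rpow (Lpnorm q (\<lambda>x. complex_of_real (normK K x powr (\<alpha> * b / p)) * f x)) (1 - \<delta>)"
    if cases: "(q = p \<and> b = -1) \<or> \<delta> = 0 \<or> \<delta> = 1" and C: "C > rpow \<bar>\<beta>\<bar> \<delta>" for C
  proof -
    obtain f x0 where f: "f \<in> C0inf_off K" "f x0 \<noteq> 0"
      using C0inf_off_nontrivial[OF K] .
    have pos: "0 < I s t f" if "0 < t" for s t
      unfolding I_def using weighted_integral_pos[OF f(1) that f(2)] .
    consider "\<delta> = 0" | "\<delta> = 1" | "0 < \<delta>" "\<delta> < 1" "q = p" "b = -1"
      using \<delta>01 cases by linarith
    then have "rpow (I (-\<alpha>) p f powr (1 / p)) \<delta> * rpow (I (\<alpha> * b / p * q) q f powr (1 / q)) (1 - \<delta>)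
        = I (\<alpha> * c / p * r) r f powr (1 / r)"
    proof cases
      case 1
      then show ?thesis using ends0 by (simp add: rpow_def)
    next
      case 2
      then show ?thesis using ends1 p by (simp add: rpow_def)
    next
      case 3
      \<comment> \<open>Here \<open>r = p\<close> and \<open>c = -1\<close>, so all three weights
        become \<open>|x'|^(-\<alpha>)\<close> and the two factors on the right are powers of one
        integral, with exponents adding to \<open>1 / p\<close>.\<close>
      have "(\<delta> + (1 - \<delta>)) * r / p = 1"
        using bal 3 by (simp only: distrib_right add_divide_distrib)
      then have "r = p" using p by simp
      moreover have "c = -1" using cdef 3 by simp
      moreover have "\<delta> / p + (1 - \<delta>) / p = 1 / p" by (simp add: diff_divide_distrib)
      ultimately show ?thesis
        using 3 p pos[of p] by (simp add: rpow_def powr_powr powr_add[symmetric])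
    qed
    moreover have "0 < I (\<alpha> * c / p * r) r f powr (1 / r)"
      using pos[OF r, of "\<alpha> * c / p * r"] by simp
    ultimately show ?thesis
      using C f(1)
      by (intro bexI[of _ f]) (simp_all add: rhs Lp mult.assoc)
  qed
  show ?thesis
    using lower sharp unfolding \<beta>_def by blast
qed

end
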